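(* Let $G$ be a compact group and let $f:G\to\mathbb{C}$ be a continuous function, not identically zero, satisfying the d'Alembert equation $$f(xy)+f(xy^{-1})=2f(x)f(y)\quad\text{for all } x,y\in G.$$ Then there is a representation $\varphi:G\to SU(2)$ such that $$f(x)=\frac{\chi_\varphi(x)}{2}\quad\text{for all } x\in G.$$
   Context: All representations are continuous: a representation $\varphi:G\to SU(2)$ is a continuous group homomorphism (not assumed irreducible) into the group $SU(2)$ of $2\times 2$ complex unitary matrices of determinant $1$. Its character is $\chi_\varphi(x)=\operatorname{tr}(\varphi(x))$. *)

theory Defs
  imports "HOL-Analysis.Analysis" "HOL-Algebra.Group"
begin

text \<open>No separation axiom is imposed, so the compact groups below include the compact Hausdorff
  groups as a special case.\<close>

locale topological_group = group G for G :: "('a, 'b) monoid_scheme" (structure) +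
  fixes T :: "'a topology"
  assumes topspace_eq_carrier: "topspace T = carrier G"
    and continuous_mult: "continuous_map (prod_topology T T) T (\<lambda>(x, y). x \<otimes> y)"
    and continuous_inv: "continuous_map T T (\<lambda>x. inv x)"

locale compact_group = topological_group +
  assumes compact_space: "compact_space T"

definition conj_transpose :: "complex^'n^'m \<Rightarrow> complex^'m^'n" where
  "conj_transpose A = (\<chi> i j. cnj (A $ j $ i))"

definition unitary_matrix :: "complex^'n^'n \<Rightarrow> bool" where
  "unitary_matrix A \<longleftrightarrow> conj_transpose A ** A = mat 1 \<and> A ** conj_transpose A = mat 1"

definition SU2 :: "(complex^2^2) monoid" where
  "SU2 = \<lparr>carrier = {A. unitary_matrix A \<and> det A = 1}, mult = (**), one = mat 1\<rparr>"

definition SU2_representation ::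
    "('a, 'b) monoid_scheme \<Rightarrow> 'a topology \<Rightarrow> ('a \<Rightarrow> complex^2^2) \<Rightarrow> bool" where
  "SU2_representation G T \<phi> \<longleftrightarrow>
     \<phi> \<in> hom G SU2 \<and> continuous_map T (subtopology euclidean (carrier SU2)) \<phi>"

definition rep_character :: "('a \<Rightarrow> complex^'n^'n) \<Rightarrow> 'a \<Rightarrow> complex" where
  "rep_character \<phi> x = trace (\<phi> x)"

end

theory Submission
  imports Defs
begin

text \<open>A bounded solution restricted to powers of one element is a sequence
  \<open>(l\<^sup>n + l\<^sup>-\<^sup>n) / 2\<close> with \<open>\<bar>l\<bar> = 1\<close>, so \<open>f\<close> is real with values in \<open>[-1, 1]\<close>. If some
  \<open>x\<close> has \<open>f x \<noteq> \<plusminus> 1\<close>, its two distinct eigenvalues \<open>l\<close>, \<open>cnj l\<close> split the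
  two-dimensional pseudocharacter \<open>2 f\<close> in the manner of Wiles: the upper left matrix entry
  \<open>diag\<close> and the products \<open>off g h\<close> of off-diagonal entries are determined by \<open>f\<close>. The matrix \<open>off\<close>
  is Hermitian of rank at most one, and \<open>f \<le> 1\<close> on commutators makes it negative
  semidefinite; factoring it as \<open>off g h = - b g * cnj (b h)\<close> gives the unitary representation.
  No integration over the group is needed.\<close>

section \<open>Bounded sequences satisfying the cosine recurrence\<close>

lemma cosine_sequence_bounded_imp:
  fixes c :: "nat \<Rightarrow> complex"
  assumes c0: "c 0 = 1" and rec: "\<And>n. c (Suc (Suc n)) = 2 * c (Suc n) * c 1 - c n"
    and bdd: "\<And>n. cmod (c n) \<le> M"
  obtains l where "cmod l = 1" "c 1 = of_real (Re l)"
proof -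
  \<comment> \<open>\<open>s\<close> is the root of the discriminant, so \<open>l\<close> and
    \<open>m\<close> are the roots of the characteristic polynomial
    \<open>t^2 - 2 (c 1) t + 1\<close>.\<close>
  define s where "s = csqrt ((c 1)\<^sup>2 - 1)"
  have s2: "s\<^sup>2 = (c 1)\<^sup>2 - 1" by (simp add: s_def)
  define l m where "l = c 1 + s" and "m = c 1 - s"
  have lm: "l * m = 1" using s2 by (simp add: l_def m_def algebra_simps power2_eq_square)
  have sum: "l + m = 2 * c 1" by (simp add: l_def m_def)
  have power_form: "2 * c n = l ^ n + m ^ n \<and> 2 * c (Suc n) = l ^ Suc n + m ^ Suc n" for n
  proof (induction n)
    case 0
    then show ?case using c0 sum by simp
  next
    case (Suc n)
    have "2 * c (Suc (Suc n)) = (2 * c (Suc n)) * (2 * c 1) - 2 * c n"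
      by (subst rec) (simp add: algebra_simps)
    also have "\<dots> = (l ^ Suc n + m ^ Suc n) * (l + m) - (l ^ n + m ^ n)"
      using Suc sum by simp
    also have "\<dots> = l ^ Suc (Suc n) + m ^ Suc (Suc n) + (l * m) * (l ^ n + m ^ n) - (l ^ n + m ^ n)"
      by (simp add: algebra_simps)
    finally show ?case using Suc lm by simp
  qed
  \<comment> \<open>A root outside the unit circle would outgrow its inverse. Applied to both roots,
    this forces modulus one.\<close>
  have no_growth: False if pq: "p * q = 1" "1 < cmod p" "\<And>n. cmod (p ^ n + q ^ n) \<le> 2 * M"
    for p q :: complex
  proof -
    obtain n where n: "2 * M + 1 < cmod p ^ n"
      using real_arch_pow[OF pq(2)] by blast
    have "cmod p * cmod q = 1" using pq(1) by (metis norm_mult norm_one)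
    then have "cmod q \<le> 1" using pq(2) by (smt (verit) mult_le_cancel_left1 norm_ge_zero mult_less_cancel_left2)
    then have "cmod q ^ n \<le> 1" by (simp add: power_le_one)
    moreover have "cmod (p ^ n) - cmod (q ^ n) \<le> cmod (p ^ n + q ^ n)"
      by (rule norm_diff_ineq)
    ultimately show False using n pq(3)[of n] by (simp add: norm_power)
  qed
  have b: "cmod (l ^ n + m ^ n) \<le> 2 * M" for n
    using power_form[of n] bdd[of n] by (metis norm_mult norm_numeral mult_le_cancel_left_pos zero_less_numeral)
  have b': "cmod (m ^ n + l ^ n) \<le> 2 * M" for n using b[of n] by (simp add: add.commute)
  have "\<not> 1 < cmod l" using no_growth[OF lm _ b] by blast
  moreover have "\<not> 1 < cmod m" using no_growth[OF _ _ b'] lm by (metis mult.commute)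
  moreover have "cmod l * cmod m = 1" using lm by (metis norm_mult norm_one)
  ultimately have l1: "cmod l = 1"
    by (smt (verit) mult_le_cancel_left1 norm_ge_zero mult_left_le)
  then have "l * cnj l = 1" by (simp add: complex_norm_square[symmetric])
  then have "m = cnj l" using lm
    by (metis mult.commute mult.left_commute mult.right_neutral)
  then have "c 1 = of_real (Re l)" using sum by (simp add: complex_add_cnj)
  with l1 show thesis using that by blast
qed

section \<open>Unit quaternions as elements of SU(2)\<close>

text \<open>The complex matrix of the quaternion \<open>a + b j\<close>.\<close>

definition quaternion_matrix :: "complex \<Rightarrow> complex \<Rightarrow> complex^2^2" where
  "quaternion_matrix a b = (\<chi> i j. if i = 1 then (if j = 1 then a else b)
                                   else (if j = 1 then - cnj b else cnj a))"

lemma quaternion_matrix_mult: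
  "quaternion_matrix a b ** quaternion_matrix c d
     = quaternion_matrix (a * c - b * cnj d) (a * d + b * cnj c)"
  by (auto simp: quaternion_matrix_def matrix_matrix_mult_def vec_eq_iff forall_2 sum_2)

lemma quaternion_matrix_in_SU2:
  assumes "a * cnj a + b * cnj b = 1"
  shows "quaternion_matrix a b \<in> carrier SU2"
  using assms
  by (auto simp: SU2_def unitary_matrix_def conj_transpose_def quaternion_matrix_def mat_def
      matrix_matrix_mult_def vec_eq_iff forall_2 sum_2 det_2 mult.commute add.commute)

lemma trace_quaternion_matrix: "trace (quaternion_matrix a b) = a + cnj a"
  by (simp add: trace_def quaternion_matrix_def sum_2)

lemma continuous_map_quaternion_matrix:
  assumes "continuous_map T euclidean a" "continuous_map T euclidean b"
  shows "continuous_map T euclidean (\<lambda>x. quaternion_matrix (a x) (b x))"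
  using assms unfolding continuous_map_atin limitin_canonical_iff quaternion_matrix_def
  by (auto intro!: tendsto_vec_lambda tendsto_cnj tendsto_minus)

text \<open>The first row determines the second by conjugation, so multiplicativity need only be
  checked on two scalar functions.\<close>

lemma SU2_representation_quaternion_matrix:
  assumes "group G" "topspace T = carrier G"
    and a: "continuous_map T euclidean a" and b: "continuous_map T euclidean b"
    and unit: "\<And>g. g \<in> carrier G \<Longrightarrow> a g * cnj (a g) + b g * cnj (b g) = 1"
    and a_mult: "\<And>g h. g \<in> carrier G \<Longrightarrow> h \<in> carrier G \<Longrightarrow>
      a (g \<otimes>\<^bsub>G\<^esub> h) = a g * a h - b g * cnj (b h)"
    and b_mult: "\<And>g h. g \<in> carrier G \<Longrightarrow> h \<in> carrier G \<Longrightarrow>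
      b (g \<otimes>\<^bsub>G\<^esub> h) = a g * b h + b g * cnj (a h)"
  shows "SU2_representation G T (\<lambda>g. quaternion_matrix (a g) (b g))"
proof -
  have "(\<lambda>g. quaternion_matrix (a g) (b g)) \<in> hom G SU2"
  proof (rule homI)
    fix g h assume gh: "g \<in> carrier G" "h \<in> carrier G"
    show "quaternion_matrix (a g) (b g) \<in> carrier SU2"
      using quaternion_matrix_in_SU2 unit gh by blast
    show "quaternion_matrix (a (g \<otimes>\<^bsub>G\<^esub> h)) (b (g \<otimes>\<^bsub>G\<^esub> h))
        = quaternion_matrix (a g) (b g) \<otimes>\<^bsub>SU2\<^esub> quaternion_matrix (a h) (b h)"
      using a_mult[OF gh] b_mult[OF gh] by (simp add: SU2_def quaternion_matrix_mult)
  qed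
  then show ?thesis
    using continuous_map_quaternion_matrix[OF a b] quaternion_matrix_in_SU2 unit assms(2)
    by (auto simp: SU2_representation_def continuous_map_in_subtopology)
qed

section \<open>Trace identities following from d'Alembert's equation\<close>

locale dalembert = group G for G :: "('a, 'b) monoid_scheme" (structure) +
  fixes f :: "'a \<Rightarrow> complex"
  assumes nonzero: "\<exists>x\<in>carrier G. f x \<noteq> 0"
    and dalembert: "x \<in> carrier G \<Longrightarrow> y \<in> carrier G \<Longrightarrow>
      f (x \<otimes> y) + f (x \<otimes> inv y) = 2 * f x * f y"
begin

lemma f_one: "f \<one> = 1"
proof -
  obtain x where "x \<in> carrier G" "f x \<noteq> 0" using nonzero by blast
  with dalembert[of x \<one>] show ?thesis by simp
qed

lemma f_inv: "x \<in> carrier G \<Longrightarrow> f (inv x) = f x"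
  using dalembert[of \<one> x] by (simp add: f_one)

lemma f_mult: "x \<in> carrier G \<Longrightarrow> y \<in> carrier G \<Longrightarrow>
    f (x \<otimes> y) = 2 * f x * f y - f (x \<otimes> inv y)"
  using dalembert[of x y] by (simp add: algebra_simps)

lemma f_commute:
  assumes "x \<in> carrier G" "y \<in> carrier G"
  shows "f (x \<otimes> y) = f (y \<otimes> x)"
proof -
  have "f (y \<otimes> inv x) = f (x \<otimes> inv y)"
    using f_inv[of "x \<otimes> inv y"] assms by (simp add: inv_mult_group)
  with f_mult[of x y] f_mult[of y x] assms show ?thesis by simp
qed

lemma f_square: "x \<in> carrier G \<Longrightarrow> f (x \<otimes> x) = 2 * f x * f x - 1"
  using f_mult[of x x] by (simp add: f_one)

text \<open>The Cayley--Hamilton identity of a trace \<open>2 f\<close> of \<open>2 \<times> 2\<close> matrices, polarized.\<close>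

lemma f_mult3:
  assumes [simp]: "x \<in> carrier G" "y \<in> carrier G" "z \<in> carrier G"
  shows "f (y \<otimes> x \<otimes> z) = 2 * (f x * f (y \<otimes> z) + f y * f (x \<otimes> z) + f z * f (x \<otimes> y))
    - 4 * f x * f y * f z - f (x \<otimes> y \<otimes> z)"
proof -
  have 1: "f (x \<otimes> y \<otimes> z) = 2 * f (x \<otimes> y) * f z - f (x \<otimes> y \<otimes> inv z)"
    by (rule f_mult) simp_all
  have 2: "f (x \<otimes> (y \<otimes> inv z)) = 2 * f x * f (y \<otimes> inv z) - f (x \<otimes> (z \<otimes> inv y))"
    using f_mult[of x "y \<otimes> inv z"] by (simp add: inv_mult_group)
  have 3: "f (x \<otimes> z \<otimes> inv y) = 2 * f (x \<otimes> z) * f y - f (x \<otimes> z \<otimes> y)"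
    using f_mult[of "x \<otimes> z" y] by simp
  have 4: "f (y \<otimes> inv z) = 2 * f y * f z - f (y \<otimes> z)"
    using f_mult[of y z] by simp
  have 5: "f (x \<otimes> z \<otimes> y) = f (y \<otimes> x \<otimes> z)"
    using f_commute[of "x \<otimes> z" y] by (simp add: m_assoc)
  show ?thesis
    using 1 2 3 4 5 by (simp add: m_assoc algebra_simps)
qed

text \<open>Fricke's identity for the trace \<open>2 f\<close> of a commutator. It results from
  evaluating \<open>f\<close> at \<open>x y y x\<close> with the product split as
  \<open>(x y)(y x)\<close> and as \<open>(x y y) x\<close>.\<close>

lemma f_commutator:
  assumes [simp]: "x \<in> carrier G" "y \<in> carrier G"
  shows "f (x \<otimes> y \<otimes> inv (y \<otimes> x))
    = 2 * (f x)\<^sup>2 + 2 * (f y)\<^sup>2 + 2 * (f (x \<otimes> y))\<^sup>2 - 4 * f x * f y * f (x \<otimes> y) - 1"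
proof -
  have 1: "f (x \<otimes> y \<otimes> y \<otimes> x) = 2 * f (x \<otimes> y) * f (x \<otimes> y) - f (x \<otimes> y \<otimes> inv (y \<otimes> x))"
    using f_mult[of "x \<otimes> y" "y \<otimes> x"] f_commute[of y x] by (simp add: m_assoc)
  have 2: "f (x \<otimes> y \<otimes> y \<otimes> x) = 2 * f (x \<otimes> y \<otimes> y) * f x - f (y \<otimes> y)"
    using f_mult[of "x \<otimes> y \<otimes> y" x] f_commute[of "x \<otimes> y \<otimes> y" "inv x"]
    by (simp add: m_assoc flip: m_assoc[of "inv x" x])
  have 3: "f (x \<otimes> y \<otimes> y) = 2 * f (x \<otimes> y) * f y - f x"
    using f_mult[of "x \<otimes> y" y] by (simp add: m_assoc)
  show ?thesis
    using 1 2 3 f_square[OF assms(2)] by algebra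
qed

lemma bounded_imp_cosine:
  assumes bdd: "\<And>x. x \<in> carrier G \<Longrightarrow> cmod (f x) \<le> M" and x: "x \<in> carrier G"
  obtains l where "cmod l = 1" "f x = of_real (Re l)"
proof -
  have "f (x [^] Suc (Suc n)) = 2 * f (x [^] Suc n) * f (x [^] (1::nat)) - f (x [^] n)" for n
    using f_mult[of "x [^] Suc n" x] x by (simp add: m_assoc)
  then show thesis
    using cosine_sequence_bounded_imp[of "\<lambda>n. f (x [^] n)" M] that bdd x
    by (auto simp: f_one)
qed

end

locale real_dalembert = dalembert +
  assumes f_cosine: "x \<in> carrier G \<Longrightarrow> \<exists>t. \<bar>t\<bar> \<le> 1 \<and> f x = of_real t"
begin

lemma cnj_f: "x \<in> carrier G \<Longrightarrow> cnj (f x) = f x"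
  using f_cosine[of x] by auto

end

section \<open>Matrix entries relative to an element with distinct eigenvalues\<close>

locale elliptic_dalembert = real_dalembert +
  fixes x :: 'a and l :: complex
  assumes x [simp]: "x \<in> carrier G" and norm_l: "l * cnj l = 1" and l_nonreal: "l \<noteq> cnj l"
    and f_x: "2 * f x = l + cnj l"
begin

text \<open>If \<open>f\<close> is half the trace of a representation diagonalizing \<open>x\<close> with eigenvalue \<open>l\<close>
  first, then \<open>diag\<close> is its upper left entry, and \<open>off g h\<close> is the product of its upper right
  entry at \<open>g\<close> and its lower left entry at \<open>h\<close>.\<close>

definition diag :: "'a \<Rightarrow> complex" where
  "diag g = 2 * (f (x \<otimes> g) - cnj l * f g) / (l - cnj l)"

definition off :: "'a \<Rightarrow> 'a \<Rightarrow> complex" where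
  "off g h = diag (g \<otimes> h) - diag g * diag h"

lemma diag_scaled: "(l - cnj l) * diag g = 2 * (f (x \<otimes> g) - cnj l * f g)"
  using l_nonreal by (simp add: diag_def)

lemma diag_mult: "diag (g \<otimes> h) = diag g * diag h + off g h"
  by (simp add: off_def)

lemma cnj_diag: "g \<in> carrier G \<Longrightarrow> cnj (diag g) = 2 * (f (x \<otimes> g) - l * f g) / (cnj l - l)"
  by (simp add: diag_def cnj_f)

lemma diag_add_cnj:
  assumes "g \<in> carrier G" shows "diag g + cnj (diag g) = 2 * f g"
proof -
  have "l - cnj l \<noteq> 0" "cnj l - l \<noteq> 0" using l_nonreal by auto
  then show ?thesis unfolding cnj_diag[OF assms] diag_def
    using assms by (simp add: divide_simps cnj_f) (simp add: algebra_simps)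
qed

lemma diag_one: "diag \<one> = 1"
  using l_nonreal f_x by (simp add: diag_def f_one right_diff_distrib)

text \<open>The trace of a product whose first factor is diagonal with entries \<open>l\<close>,
  \<open>cnj l\<close>.\<close>

lemma f_x_mult:
  assumes "g \<in> carrier G"
  shows "2 * f (x \<otimes> g) = l * diag g + cnj l * cnj (diag g)"
proof -
  have "l - cnj l \<noteq> 0" "cnj l - l \<noteq> 0" using l_nonreal by auto
  then show ?thesis unfolding cnj_diag[OF assms] diag_def
    using assms by (simp add: divide_simps cnj_f) (simp add: algebra_simps)
qed

text \<open>Models writing the diagonal matrix of \<open>x\<close> as \<open>cnj l\<close> times the
  identity plus \<open>l - cnj l\<close> times the projection onto the first coordinate.\<close>

lemma diag_sandwich:
  assumes [simp]: "u \<in> carrier G" "v \<in> carrier G"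
  shows "diag (u \<otimes> x \<otimes> v) = cnj l * diag (u \<otimes> v) + (l - cnj l) * diag u * diag v"
proof -
  define k where "k = l - cnj l"
  have k: "k \<noteq> 0" using l_nonreal by (simp add: k_def)
  have "f (x \<otimes> u \<otimes> (x \<otimes> v)) = 2 * f (x \<otimes> u) * f (x \<otimes> v) - f (x \<otimes> u \<otimes> inv (x \<otimes> v))"
    by (rule f_mult) simp_all
  moreover have "f (x \<otimes> u \<otimes> inv (x \<otimes> v)) = f (u \<otimes> inv v)"
    using f_commute[of x "u \<otimes> inv v \<otimes> inv x"] by (simp add: inv_mult_group m_assoc)
  moreover have "f (u \<otimes> inv v) = 2 * f u * f v - f (u \<otimes> v)"
    using f_mult[of u v] by simp
  ultimately have 1: "f (x \<otimes> (u \<otimes> x \<otimes> v)) = 2 * f (x \<otimes> u) * f (x \<otimes> v) - 2 * f u * f v + f (u \<otimes> v)"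
    by (simp add: m_assoc)
  have 2: "f (u \<otimes> x \<otimes> v) = (l + cnj l) * f (u \<otimes> v) + 2 * (f u * f (x \<otimes> v) + f v * f (x \<otimes> u))
      - 2 * (l + cnj l) * f u * f v - f (x \<otimes> (u \<otimes> v))"
    using f_mult3[of x u v] unfolding f_x[symmetric] by (simp add: m_assoc algebra_simps)
  have "k * diag (u \<otimes> x \<otimes> v) = cnj l * (k * diag (u \<otimes> v)) + (k * diag u) * (k * diag v)"
    unfolding k_def diag_scaled 1 2 using norm_l by algebra
  then have "k * diag (u \<otimes> x \<otimes> v) = k * (cnj l * diag (u \<otimes> v) + k * diag u * diag v)"
    by (simp add: algebra_simps)
  then show ?thesis using k by (simp add: k_def)
qed

text \<open>Cyclic invariance of \<open>f\<close> on \<open>u v\<close> and on \<open>u x v\<close>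
  gives two linear relations; as \<open>l\<close> is not real, they force the symmetry.\<close>

lemma cnj_off:
  assumes [simp]: "u \<in> carrier G" "v \<in> carrier G"
  shows "cnj (off u v) = off v u"
proof -
  have "2 * f (u \<otimes> x \<otimes> v) = 2 * f (x \<otimes> (v \<otimes> u))"
    using f_commute[of u "x \<otimes> v"] by (simp add: m_assoc)
  then have 1: "diag (u \<otimes> x \<otimes> v) + cnj (diag (u \<otimes> x \<otimes> v))
      = l * diag (v \<otimes> u) + cnj l * cnj (diag (v \<otimes> u))"
    by (simp add: f_x_mult diag_add_cnj)
  have 2: "diag (u \<otimes> v) + cnj (diag (u \<otimes> v)) = diag (v \<otimes> u) + cnj (diag (v \<otimes> u))"
    using f_commute[of u v] by (simp add: diag_add_cnj)
  have "(l - cnj l) * (cnj (off u v) - off v u) = 0"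
    using 1 2 unfolding diag_sandwich[OF assms] off_def
    by (simp add: diag_mult) algebra
  then show ?thesis using l_nonreal by simp
qed

text \<open>Inserting \<open>x\<close> between \<open>h\<close> and \<open>k\<close> can be
  evaluated in the second argument directly or, via \<open>cnj_off\<close>, in the first. Comparing
  the results isolates \<open>off g (h \<otimes> k)\<close>.\<close>

lemma off_mult_right:
  assumes [simp]: "g \<in> carrier G" "h \<in> carrier G" "k \<in> carrier G"
  shows "off g (h \<otimes> k) = off g h * diag k + cnj (diag h) * off g k"
proof -
  have 1: "off g (h \<otimes> x \<otimes> k) = cnj l * off g (h \<otimes> k) + (l - cnj l) * off g h * diag k"
    using diag_sandwich[of "g \<otimes> h" k] diag_sandwich[of h k]
    by (simp add: off_def m_assoc) (simp add: algebra_simps)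
  have 2: "off g (h \<otimes> x \<otimes> k) = l * off g (h \<otimes> k) + (cnj l - l) * cnj (diag h) * off g k"
  proof -
    have "off (h \<otimes> x \<otimes> k) g = cnj l * off (h \<otimes> k) g + (l - cnj l) * diag h * off k g"
      using diag_sandwich[of h "k \<otimes> g"] diag_sandwich[of h k]
      by (simp add: off_def m_assoc) (simp add: algebra_simps)
    then have "cnj (off (h \<otimes> x \<otimes> k) g)
        = l * cnj (off (h \<otimes> k) g) + (cnj l - l) * cnj (diag h) * cnj (off k g)"
      by simp
    then show ?thesis by (simp add: cnj_off)
  qed
  have "(l - cnj l) * off g (h \<otimes> k)
      = (l - cnj l) * (off g h * diag k + cnj (diag h) * off g k)"
    using 1 2 by algebra
  then show ?thesis using l_nonreal by simp
qed

lemma off_mult_left: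
  assumes [simp]: "g \<in> carrier G" "h \<in> carrier G" "k \<in> carrier G"
  shows "off (g \<otimes> h) k = diag g * off h k + off g k * cnj (diag h)"
proof -
  have "cnj (off k (g \<otimes> h)) = cnj (off k g * diag h + cnj (diag g) * off k h)"
    by (simp add: off_mult_right)
  then show ?thesis by (simp add: cnj_off)
qed

text \<open>\<open>off\<close> has rank one: expand \<open>off g (h \<otimes> k \<otimes> m)\<close> along both bracketings.\<close>

lemma off_exchange:
  assumes [simp]: "g \<in> carrier G" "h \<in> carrier G" "k \<in> carrier G" "m \<in> carrier G"
  shows "off g h * off k m = off k h * off g m"
proof -
  have "off g (h \<otimes> (k \<otimes> m)) = off g (h \<otimes> k \<otimes> m)" by (simp add: m_assoc)
  then have "off g h * diag (k \<otimes> m) + cnj (diag h) * off g (k \<otimes> m)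
      = off g (h \<otimes> k) * diag m + cnj (diag (h \<otimes> k)) * off g m"
    by (simp only: off_mult_right assms m_closed)
  then show ?thesis
    by (simp add: diag_mult off_mult_right cnj_off algebra_simps)
qed

text \<open>The upper left entry of the Cayley-Hamilton relation \<open>g^2 = 2 f(g) g - 1\<close>.
  It later becomes the determinant condition.\<close>

lemma off_self:
  assumes [simp]: "g \<in> carrier G"
  shows "off g g = diag g * cnj (diag g) - 1"
proof -
  have "f (x \<otimes> g \<otimes> g) = 2 * f (x \<otimes> g) * f g - f x" "f (g \<otimes> g) = 2 * f g * f g - 1"
    using f_mult[of "x \<otimes> g" g] f_square[of g] by (simp_all add: m_assoc)
  \<comment> \<open>\<open>diag \<one>\<close> stays unevaluated so that \<open>diag_scaled\<close>
    rewrites every term.\<close>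
  then have "(l - cnj l) * diag (g \<otimes> g) = (l - cnj l) * (2 * f g * diag g - diag \<one>)"
    unfolding right_diff_distrib[of "l - cnj l" "2 * f g * diag g"]
      mult.left_commute[of "l - cnj l" "2 * f g"] diag_scaled
    by (simp add: m_assoc f_one) (simp add: algebra_simps)
  then have "diag (g \<otimes> g) = 2 * f g * diag g - diag \<one>"
    using l_nonreal by simp
  then show ?thesis
    by (simp add: off_def diag_one flip: diag_add_cnj) (simp add: algebra_simps)
qed

text \<open>A commutator has \<open>f\<close>-value \<open>1 - 2 d\<close> for the Gram determinant \<open>d\<close> of \<open>1, x, g\<close>, so
  \<open>f \<le> 1\<close> gives \<open>d \<ge> 0\<close>.\<close>

lemma cmod_diag_le:
  assumes [simp]: "g \<in> carrier G"
  shows "cmod (diag g) \<le> 1"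
proof -
  obtain p where p: "f x = of_real p" using f_cosine[of x] by auto
  obtain q where q: "f g = of_real q" using f_cosine[of g] by auto
  obtain r where r: "f (x \<otimes> g) = of_real r" using f_cosine[of "x \<otimes> g"] by auto
  obtain t where t: "\<bar>t\<bar> \<le> 1" "f (x \<otimes> g \<otimes> inv (g \<otimes> x)) = of_real t"
    using f_cosine[of "x \<otimes> g \<otimes> inv (g \<otimes> x)"] by auto
  have "complex_of_real t = of_real (2 * p\<^sup>2 + 2 * q\<^sup>2 + 2 * r\<^sup>2 - 4 * p * q * r - 1)"
    using f_commutator[of x g] t(2) p q r by simp
  then have "t = 2 * p\<^sup>2 + 2 * q\<^sup>2 + 2 * r\<^sup>2 - 4 * p * q * r - 1"
    by (simp only: of_real_eq_iff)
  then have gram: "q\<^sup>2 + r\<^sup>2 - 2 * p * q * r \<le> 1 - p\<^sup>2" using t(1) by simp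
  have pl: "Re l = p" using f_x p by (simp add: complex_eq_iff)
  have "(Re l)\<^sup>2 + (Im l)\<^sup>2 = 1" using norm_l by (simp add: complex_eq_iff power2_eq_square)
  then have s: "(Im l)\<^sup>2 = 1 - p\<^sup>2" using pl by simp
  have im: "0 < (Im l)\<^sup>2" using l_nonreal by (auto simp: complex_eq_iff)
  have "(l - cnj l) = Complex 0 (2 * Im l)" by (simp add: complex_eq_iff)
  then have kk: "(cmod (l - cnj l))\<^sup>2 = 4 * (Im l)\<^sup>2" by (simp add: cmod_def power_mult_distrib)
  have "(cmod (f (x \<otimes> g) - cnj l * f g))\<^sup>2 = (r - p * q)\<^sup>2 + (Im l * q)\<^sup>2"
    by (simp add: cmod_power2 q r pl)
  also have "\<dots> = q\<^sup>2 + r\<^sup>2 - 2 * p * q * r"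
    by (simp add: power_mult_distrib s) (simp add: power2_eq_square algebra_simps)
  finally have "(cmod (diag g))\<^sup>2 = (q\<^sup>2 + r\<^sup>2 - 2 * p * q * r) / (Im l)\<^sup>2"
    by (simp add: diag_def norm_divide norm_mult power_divide power_mult_distrib kk
        del: right_diff_distrib_numeral)
  also have "\<dots> \<le> 1" using gram s im by simp
  finally show ?thesis using abs_square_le_1[of "cmod (diag g)"] by simp
qed

lemma off_factorization:
  obtains r z where "r \<in> carrier G"
    and "\<And>g h. g \<in> carrier G \<Longrightarrow> h \<in> carrier G \<Longrightarrow> off g h = - (z * off g r) * cnj (z * off h r)"
proof (cases "\<forall>r\<in>carrier G. off r r = 0")
  case True
  have "off g h = 0" if "g \<in> carrier G" "h \<in> carrier G" for g h
  proof -
    \<comment> \<open>Rank one and Hermitian symmetry turn this into a product of two diagonal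
      values.\<close>
    have "off g h * cnj (off g h) = 0"
      using off_exchange[of g h h g] True that by (simp add: cnj_off)
    then show ?thesis by simp
  qed
  then show thesis using that[of \<one> 0] by simp
next
  case False
  then obtain r where r [simp]: "r \<in> carrier G" and nz: "off r r \<noteq> 0" by blast
  define m where "m = 1 - (cmod (diag r))\<^sup>2"
  have rr: "off r r = - of_real m"
    by (simp add: off_self m_def complex_norm_square flip: of_real_power)
  have "0 \<le> m" using cmod_diag_le[of r] by (simp add: m_def power_le_one)
  with rr nz have m: "0 < m" by (cases "m = 0") auto
  show thesis
  \<comment> \<open>Column \<open>r\<close> determines \<open>off\<close> up to the factor
    \<open>1 / off r r = -1 / m\<close>; positivity of \<open>m\<close> lets
    \<open>1 / sqrt m\<close> be absorbed into each factor.\<close>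
  proof (rule that[of r "of_real (1 / sqrt m)"])
    fix g h assume [simp]: "g \<in> carrier G" "h \<in> carrier G"
    have "off g r * off r h = off r r * off g h"
      by (rule off_exchange) simp_all
    then have "off g h = - (off g r * cnj (off h r)) / of_real m"
      using m by (simp add: rr cnj_off field_simps)
    also have "complex_of_real m = of_real (sqrt m) * of_real (sqrt m)"
      using m by (simp flip: of_real_mult)
    finally show "off g h = - (of_real (1 / sqrt m) * off g r) * cnj (of_real (1 / sqrt m) * off h r)"
      by simp
  qed simp
qed

end

section \<open>Construction of the representation\<close>

theorem theorem3p1:
  fixes G :: "('a, 'b) monoid_scheme" and T :: "'a topology" and f :: "'a \<Rightarrow> complex"
  assumes "compact_group G T"
    and "continuous_map T euclidean f"
    and "\<exists>x\<in>carrier G. f x \<noteq> 0"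
    and "\<And>x y. x \<in> carrier G \<Longrightarrow> y \<in> carrier G \<Longrightarrow>
           f (x \<otimes>\<^bsub>G\<^esub> y) + f (x \<otimes>\<^bsub>G\<^esub> inv\<^bsub>G\<^esub> y) = 2 * f x * f y"
  shows "\<exists>\<phi>. SU2_representation G T \<phi> \<and>
           (\<forall>x\<in>carrier G. f x = rep_character \<phi> x / 2)"
proof -
  interpret compact_group G T by fact
  interpret dalembert G f by unfold_locales (use assms in auto)
  have "compact (f ` carrier G)"
    using image_compactin[OF compact_space[unfolded compact_space_def] assms(2)]
    by (simp add: topspace_eq_carrier)
  then obtain M where "\<And>x. x \<in> carrier G \<Longrightarrow> cmod (f x) \<le> M"
    by (metis compact_imp_bounded bounded_iff imageI)
  then have cosine: "\<exists>l. cmod l = 1 \<and> f x = of_real (Re l)" if "x \<in> carrier G" for x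
    using bounded_imp_cosine that by metis
  interpret real_dalembert G f
    by unfold_locales (metis cosine abs_Re_le_cmod)
  show ?thesis
  proof (cases "\<forall>x\<in>carrier G. f x = 1 \<or> f x = -1")
    case True
    have hom: "f (g \<otimes>\<^bsub>G\<^esub> h) = f g * f h" if "g \<in> carrier G" "h \<in> carrier G" for g h
    proof -
      have "g \<otimes>\<^bsub>G\<^esub> h \<in> carrier G" "g \<otimes>\<^bsub>G\<^esub> inv\<^bsub>G\<^esub> h \<in> carrier G" using that by auto
      with True that have "f (g \<otimes>\<^bsub>G\<^esub> h) = 1 \<or> f (g \<otimes>\<^bsub>G\<^esub> h) = -1"
        "f (g \<otimes>\<^bsub>G\<^esub> inv\<^bsub>G\<^esub> h) = 1 \<or> f (g \<otimes>\<^bsub>G\<^esub> inv\<^bsub>G\<^esub> h) = -1" "f g = 1 \<or> f g = -1" "f h = 1 \<or> f h = -1"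
        by blast+
      \<comment> \<open>Two signs whose sum is \<open>2\<close> or \<open>-2\<close> must
        coincide.\<close>
      with dalembert[OF that] show ?thesis by auto
    qed
    \<comment> \<open>Here the representation is scalar: \<open>f g\<close> times the
      identity.\<close>
    have "SU2_representation G T (\<lambda>g. quaternion_matrix (f g) 0)"
      by (rule SU2_representation_quaternion_matrix)
         (use True hom assms(2) in \<open>auto simp: topspace_eq_carrier is_group cnj_f\<close>)
    then show ?thesis
      by (intro exI[of _ "\<lambda>g. quaternion_matrix (f g) 0"])
         (simp add: rep_character_def trace_quaternion_matrix cnj_f)
  next
    case False
    then obtain x where x: "x \<in> carrier G" "f x \<noteq> 1" "f x \<noteq> -1" by blast
    obtain l where l: "cmod l = 1" "f x = of_real (Re l)" using cosine[OF x(1)] by blast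
    interpret elliptic_dalembert G f x l
    proof
      show "l * cnj l = 1" using l(1) by (simp flip: complex_norm_square)
      show "2 * f x = l + cnj l" using l(2) by (simp add: complex_add_cnj)
      show "l \<noteq> cnj l"
      proof
        \<comment> \<open>A real \<open>l\<close> of modulus one would give \<open>f x\<close> one
          of the excluded values.\<close>
        assume "l = cnj l"
        then have "Im l = 0" by (simp add: complex_eq_iff)
        with l(1) have "\<bar>Re l\<bar> = 1" by (simp add: cmod_def)
        with l(2) x show False by (auto simp: abs_if split: if_splits)
      qed
    qed fact
    obtain r z where r: "r \<in> carrier G"
      and fact: "\<And>g h. g \<in> carrier G \<Longrightarrow> h \<in> carrier G \<Longrightarrow> off g h = - (z * off g r) * cnj (z * off h r)"
      using off_factorization by blast
    \<comment> \<open>\<open>diag\<close> and \<open>off\<close> are built from translates of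
      \<open>f\<close>, so continuity of translations suffices.\<close>
    have left: "continuous_map T euclidean (\<lambda>g. f (u \<otimes>\<^bsub>G\<^esub> g))" if "u \<in> carrier G" for u
    proof -
      have "continuous_map T (prod_topology T T) (\<lambda>g. (u, g))"
        using that by (simp add: continuous_map_pairwise o_def topspace_eq_carrier)
      from continuous_map_compose[OF continuous_map_compose[OF this continuous_mult] assms(2)]
      show ?thesis by (simp add: o_def)
    qed
    have right: "continuous_map T T (\<lambda>g. g \<otimes>\<^bsub>G\<^esub> r)"
    proof -
      have "continuous_map T (prod_topology T T) (\<lambda>g. (g, r))"
        using r by (simp add: continuous_map_pairwise o_def topspace_eq_carrier)
      from continuous_map_compose[OF this continuous_mult] show ?thesis by (simp add: o_def)
    qed
    have diag: "continuous_map T euclidean diag"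
      using left[OF x(1)] assms(2) l_nonreal
      unfolding continuous_map_atin limitin_canonical_iff diag_def[abs_def]
      by (auto intro!: tendsto_intros)
    have "continuous_map T euclidean (\<lambda>g. diag (g \<otimes>\<^bsub>G\<^esub> r))"
      using continuous_map_compose[OF right diag] by (simp add: o_def)
    with diag have off: "continuous_map T euclidean (\<lambda>g. z * off g r)"
      unfolding continuous_map_atin limitin_canonical_iff off_def[abs_def]
      by (auto intro!: tendsto_intros)
    have "SU2_representation G T (\<lambda>g. quaternion_matrix (diag g) (z * off g r))"
    proof (rule SU2_representation_quaternion_matrix[OF is_group topspace_eq_carrier diag off])
      fix g assume g: "g \<in> carrier G"
      \<comment> \<open>On the diagonal, the factorization makes \<open>off g g\<close> minus the
        squared modulus of the second entry.\<close>
      show "diag g * cnj (diag g) + z * off g r * cnj (z * off g r) = 1"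
        using fact[OF g g] off_self[OF g] by (simp add: algebra_simps)
      fix h assume h: "h \<in> carrier G"
      show "diag (g \<otimes>\<^bsub>G\<^esub> h) = diag g * diag h - z * off g r * cnj (z * off h r)"
        using fact[OF g h] by (simp add: diag_mult)
      show "z * off (g \<otimes>\<^bsub>G\<^esub> h) r = diag g * (z * off h r) + z * off g r * cnj (diag h)"
        using g h r by (simp add: off_mult_left algebra_simps)
    qed
    then show ?thesis
      by (intro exI[of _ "\<lambda>g. quaternion_matrix (diag g) (z * off g r)"])
         (simp add: rep_character_def trace_quaternion_matrix diag_add_cnj)
  qed
qed

end
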